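(* Let $\mathbb{X}=(X,\langle\cdot,\cdot\rangle,\xi)$ be a gm-space with $X\subset\mathbb{R}^d$ and gauge the Euclidean scalar product, and let $n\in\mathbb{N}$, $n\ge1$. Then there exists a measurable map $T\colon X\to[n]$ such that, for the disjoint partition $V_i:=T^{-1}(\{i\})$, $i\in[n]$, the gm-space $$\hat{\mathbb{Y}}:=([n],\hat G,\hat\upsilon)\in\mathfrak{GM}_n,\qquad \hat G_{i,i'}:=\langle\mathrm{m}_\xi(V_i),\mathrm{m}_\xi(V_{i'})\rangle,\qquad \hat\upsilon:=\sum_{i=1}^n\xi(V_i)\,\delta_i,$$ is a solution of the GW quantization problem for $\mathbb{X}$, i.e. $\mathrm{GW}_2(\mathbb{X},\hat{\mathbb{Y}})=\inf_{\mathbb{Y}\in\mathfrak{GM}_n}\mathrm{GW}_2(\mathbb{X},\mathbb{Y})$, and $(\mathrm{Id},T)_\#\xi\in\Pi_{\mathrm o}(\mathbb{X},\hat{\mathbb{Y}})$.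
   Context: A gauged measure space (gm-space) is a triple $(X,g,\xi)$ where $X$ is a Polish space, $\xi$ is a Borel probability measure on $X$, and the gauge $g\in L^2(X\times X,\xi\otimes\xi)$ is symmetric. For gm-spaces $\mathbb{X}=(X,g,\xi)$ and $\mathbb{Y}=(Y,h,\upsilon)$, with $\Pi(\xi,\upsilon)$ the set of couplings of $\xi$ and $\upsilon$, $$\mathrm{GW}_2(\mathbb{X},\mathbb{Y})=\inf_{\pi\in\Pi(\xi,\upsilon)}\Big(\iint_{(X\times Y)^2}|g(x,x')-h(y,y')|^2\,\mathrm{d}\pi(x,y)\,\mathrm{d}\pi(x',y')\Big)^{1/2},$$ and $\Pi_{\mathrm o}(\mathbb{X},\mathbb{Y})$ is the (non-empty) set of minimizing couplings. Write $[n]=\{1,\dots,n\}$. $\mathfrak{GM}_n$ is the set of gm-spaces $([n],G,\upsilon)$ with $G\in\mathbb{R}^{n\times n}$ symmetric (viewed as the gauge $(i,i')\mapsto G_{i,i'}$) and $\upsilon$ a probability measure on $[n]$. For measurable $V\subset X$, $\mathrm{m}_\xi(V):=\frac{1}{\xi(V)}\int_V x\,\mathrm{d}\xi(x)$ if $\xi(V)>0$, and $\mathrm{m}_\xi(V)\in X$ is set arbitrarily if $\xi(V)=0$. *)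

theory Defs
  imports "HOL-Probability.Probability"
begin

definition polish_topology :: "'a topology \<Rightarrow> bool" where
  "polish_topology X \<longleftrightarrow> completely_metrizable_space X \<and> separable_space X"

definition borel_of :: "'a topology \<Rightarrow> 'a measure" where
  "borel_of X = sigma (topspace X) {U. openin X U}"

text \<open>
  A gauge is an element of \<open>L\<^sup>2\<close>, given here by a representative; symmetry is therefore required
  only almost everywhere. Values of the representative outside the space are irrelevant.
\<close>

type_synonym 'a gm = "'a topology \<times> ('a \<Rightarrow> 'a \<Rightarrow> real) \<times> 'a measure"

fun gm_space :: "'a gm \<Rightarrow> bool" where
  "gm_space (X, g, \<xi>) \<longleftrightarrow>
     polish_topology X \<and>
     prob_space \<xi> \<and> sets \<xi> = sets (borel_of X) \<and>
     (\<lambda>(x, x'). g x x') \<in> borel_measurable (\<xi> \<Otimes>\<^sub>M \<xi>) \<and>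
     integrable (\<xi> \<Otimes>\<^sub>M \<xi>) (\<lambda>(x, x'). (g x x')\<^sup>2) \<and>
     (AE (x, x') in \<xi> \<Otimes>\<^sub>M \<xi>. g x x' = g x' x)"

text \<open>
  For Polish spaces the Borel sigma-algebra of the product is the product sigma-algebra.
\<close>

definition couplings :: "'a measure \<Rightarrow> 'b measure \<Rightarrow> ('a \<times> 'b) measure set" where
  "couplings \<xi> \<upsilon> =
     {\<pi>. sets \<pi> = sets (\<xi> \<Otimes>\<^sub>M \<upsilon>) \<and> distr \<pi> \<xi> fst = \<xi> \<and> distr \<pi> \<upsilon> snd = \<upsilon>}"

text \<open>
  For gm-spaces and a coupling \<open>\<pi>\<close> the integrand is integrable, since both gauges are
  square integrable; so the Bochner integral does not take its default value here.
\<close>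

definition distortion ::
  "('a \<Rightarrow> 'a \<Rightarrow> real) \<Rightarrow> ('b \<Rightarrow> 'b \<Rightarrow> real) \<Rightarrow> ('a \<times> 'b) measure \<Rightarrow> real" where
  "distortion g h \<pi> =
     sqrt (\<integral>((x, y), (x', y')). \<bar>g x x' - h y y'\<bar>\<^sup>2 \<partial>(\<pi> \<Otimes>\<^sub>M \<pi>))"

fun GW2 :: "'a gm \<Rightarrow> 'b gm \<Rightarrow> real" where
  "GW2 (X, g, \<xi>) (Y, h, \<upsilon>) = (INF \<pi>\<in>couplings \<xi> \<upsilon>. distortion g h \<pi>)"

fun optimal_couplings :: "'a gm \<Rightarrow> 'b gm \<Rightarrow> ('a \<times> 'b) measure set" where
  "optimal_couplings (X, g, \<xi>) (Y, h, \<upsilon>) =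
     {\<pi> \<in> couplings \<xi> \<upsilon>. \<forall>\<pi>'\<in>couplings \<xi> \<upsilon>. distortion g h \<pi> \<le> distortion g h \<pi>'}"

definition GM :: "nat \<Rightarrow> nat gm set" where
  "GM n = {(discrete_topology {1..n}, G, \<upsilon>) | G \<upsilon>.
     (\<forall>i\<in>{1..n}. \<forall>i'\<in>{1..n}. G i i' = G i' i) \<and>
     prob_space \<upsilon> \<and> sets \<upsilon> = Pow {1..n}}"

text \<open>
  \<open>m\<close> is an admissible choice of the means \<open>m\<^sub>\<xi>(V)\<close> of measurable sets: on null sets its value is
  an arbitrary point of \<open>X\<close>.
\<close>

definition mean_map ::
  "'a::euclidean_space set \<Rightarrow> 'a measure \<Rightarrow> ('a set \<Rightarrow> 'a) \<Rightarrow> bool" where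
  "mean_map X \<xi> m \<longleftrightarrow>
     (\<forall>V\<in>sets \<xi>.
        (measure \<xi> V > 0 \<longrightarrow> m V = (1 / measure \<xi> V) *\<^sub>R (LINT x:V|\<xi>. x)) \<and>
        (measure \<xi> V = 0 \<longrightarrow> m V \<in> X))"

end

theory Submission
  imports Defs
begin

text \<open>
  Let \<open>\<pi>\<close> be a coupling of \<open>\<xi>\<close> with a law on \<open>{1..n}\<close>, written as the law of
  a pair \<open>(x, y)\<close>. Let \<open>p\<^sub>i\<close> be the mass of the \<open>i\<close>-th cell
  \<open>{y = i}\<close> and \<open>b\<^sub>i\<close> the integral of \<open>x\<close> over it. Expanding the square gives, for every matrix \<open>G\<close>,
  the squared distortion as
  \<open>\<parallel>K\<parallel>\<^sup>2 - \<parallel>Q\<parallel>\<^sup>2 + (\<Sum>i j. p\<^sub>i p\<^sub>j (G\<^sub>i\<^sub>j - \<langle>b\<^sub>i/p\<^sub>i, b\<^sub>j/p\<^sub>j\<rangle>)\<^sup>2)\<close>, in Frobenius norms, where \<open>K\<close> is the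
  second moment matrix of \<open>\<xi>\<close> and \<open>Q = (\<Sum>i. b\<^sub>i b\<^sub>i\<^sup>T / p\<^sub>i)\<close> is the second moment matrix after every
  point has been moved to the mean of its cell (\<open>integral_gauge_difference\<close>). The scalar products of
  the means are thus the best gauge, and it remains to maximise \<open>\<parallel>Q\<parallel>\<close> over couplings and to see that
  a map attains the maximum.

  A coupling is never better than a map: \<open>\<parallel>Q\<parallel>\<close> is convex in \<open>(p, b)\<close>, and a linear functional of \<open>(p, b)\<close>
  that supports it, up to a positive factor, at a given coupling is the integral of affine functions \<open>l\<^sub>i(x)\<close> over the cells. That integral only grows
  when each \<open>x\<close> is sent to an index at which \<open>l\<^sub>i(x)\<close> is largest
  (\<open>exists_affine_label_improvement\<close>). So only partitions of this kind, given by \<open>n\<close> affine functions,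
  compete.

  The maximum is attained because such partitions are sequentially compact in a strong sense: along a
  subsequence, every point eventually keeps its label. This rests on the fact that a sequence of
  homogeneous half-spaces always has a subsequence along which membership of every point stabilises
  (\<open>exists_subseq_eventually_signed\<close>). The limiting partition need not be given by affine functions,
  but dominated convergence shows that its \<open>Q\<close> is the limit of theirs
  (\<open>exists_label_dominating_affine_labels\<close>).
\<close>

section \<open>Rank-one matrices and product integrals\<close>

text \<open>
  The inner product of \<open>real ^ 'd ^ 'd\<close> is the Frobenius product, so rank-one matrices turn the squared
  scalar products of the problem into scalar products, and Cauchy--Schwarz becomes available for them.
\<close>

definition outer :: "real ^ 'd \<Rightarrow> real ^ 'd ^ 'd" where
  "outer u = (\<chi> k l. u $ k * u $ l)"

lemma inner_outer: "outer u \<bullet> outer v = (u \<bullet> v)\<^sup>2"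
  by (simp add: outer_def inner_vec_def power2_eq_square sum_product algebra_simps)

lemma norm_outer: "norm (outer u) = (norm u)\<^sup>2"
  by (simp add: norm_eq_sqrt_inner inner_outer)

lemma continuous_outer: "continuous_on UNIV outer"
  unfolding outer_def by (intro continuous_intros)

lemma borel_measurable_outer [measurable]: "outer \<in> borel_measurable borel"
  by (intro borel_measurable_continuous_onI continuous_outer)

text \<open>
  Fubini. All terms of the expanded squared distortion, including \<open>(x \<bullet> x')\<^sup>2 = outer x \<bullet> outer x'\<close>,
  have this form.
\<close>

lemma integrable_inner_pair:
  fixes f g :: "'w \<Rightarrow> 'b::euclidean_space"
  assumes "prob_space M" and f: "integrable M f" and g: "integrable M g"
  shows "integrable (M \<Otimes>\<^sub>M M) (\<lambda>(w, w'). f w \<bullet> g w')"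
    and "(\<integral>(w, w'). f w \<bullet> g w' \<partial>(M \<Otimes>\<^sub>M M)) = (\<integral>w. f w \<partial>M) \<bullet> (\<integral>w. g w \<partial>M)"
proof -
  interpret prob_space M by fact
  interpret pair_sigma_finite M M ..
  have [measurable]: "f \<in> borel_measurable M" "g \<in> borel_measurable M"
    using f g by auto
  have "integrable (M \<Otimes>\<^sub>M M) (\<lambda>z. norm (f (fst z)) * norm (g (snd z)))"
  proof (rule Fubini_integrable)
    show "integrable M (\<lambda>w. \<integral>w'. norm (norm (f (fst (w, w'))) * norm (g (snd (w, w')))) \<partial>M)"
      using f by simp
    show "AE w in M. integrable M (\<lambda>w'. norm (f (fst (w, w'))) * norm (g (snd (w, w'))))"
      using g by simp
  qed simp
  then show int: "integrable (M \<Otimes>\<^sub>M M) (\<lambda>(w, w'). f w \<bullet> g w')"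
    by (rule Bochner_Integration.integrable_bound)
       (auto simp: split_beta' norm_mult Cauchy_Schwarz_ineq2)
  show "(\<integral>(w, w'). f w \<bullet> g w' \<partial>(M \<Otimes>\<^sub>M M)) = (\<integral>w. f w \<partial>M) \<bullet> (\<integral>w. g w \<partial>M)"
    using integral_fst'[OF int] f g by simp
qed

section \<open>Masses, moments and energies of the cells of a labelled random vector\<close>

definition cell_mass :: "'w measure \<Rightarrow> ('w \<Rightarrow> nat) \<Rightarrow> nat \<Rightarrow> real" where
  "cell_mass M y i = (\<integral>w. indicator {i} (y w) \<partial>M)"

definition cell_moment :: "'w measure \<Rightarrow> ('w \<Rightarrow> 'a::euclidean_space) \<Rightarrow> ('w \<Rightarrow> nat) \<Rightarrow> nat \<Rightarrow> 'a" where
  "cell_moment M x y i = (\<integral>w. indicator {i} (y w) *\<^sub>R x w \<partial>M)"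

definition cell_energy :: "'w measure \<Rightarrow> ('w \<Rightarrow> 'a::euclidean_space) \<Rightarrow> ('w \<Rightarrow> nat) \<Rightarrow> nat \<Rightarrow> real" where
  "cell_energy M x y i = (\<integral>w. indicator {i} (y w) * (norm (x w))\<^sup>2 \<partial>M)"

text \<open>
  The second moment matrix of the random vector that takes the mean value of \<open>x\<close> on each cell. Null
  cells contribute nothing, since \<open>1 / 0 = 0\<close>.
\<close>

definition quantized_moment ::
  "'w measure \<Rightarrow> ('w \<Rightarrow> real ^ 'd) \<Rightarrow> ('w \<Rightarrow> nat) \<Rightarrow> nat \<Rightarrow> real ^ 'd ^ 'd" where
  "quantized_moment M x y n =
     (\<Sum>i\<in>{1..n}. (1 / cell_mass M y i) *\<^sub>R outer (cell_moment M x y i))"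

text \<open>
  Both a coupling (with \<open>fst\<close> and \<open>snd\<close>) and the measure \<open>\<xi>\<close> with a labelling map (with the identity
  and the map) are instances. This allows the two to be compared.
\<close>

locale labelled_sample = prob_space M for M :: "'w measure" +
  fixes x :: "'w \<Rightarrow> real ^ 'd" and y :: "'w \<Rightarrow> nat" and n :: nat
  assumes x_meas [measurable]: "x \<in> borel_measurable M"
    and sq_int: "integrable M (\<lambda>w. (norm (x w))\<^sup>2)"
    and y_meas [measurable]: "y \<in> M \<rightarrow>\<^sub>M count_space UNIV"
    and y_range: "\<And>w. w \<in> space M \<Longrightarrow> y w \<in> {1..n}"
begin

lemma x_int: "integrable M x"
proof (rule Bochner_Integration.integrable_bound)
  show "integrable M (\<lambda>w. 1 + (norm (x w))\<^sup>2)" using sq_int by simp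
  have "t \<le> 1 + t\<^sup>2" for t :: real
  proof -
    have "0 \<le> (t - 1)\<^sup>2 + t\<^sup>2 + 1" by simp
    then show ?thesis by (simp add: power2_diff)
  qed
  then show "AE w in M. norm (x w) \<le> norm (1 + (norm (x w))\<^sup>2)" by simp
qed simp

lemma cell_int:
  "integrable M (\<lambda>w. indicator {i} (y w) :: real)"
  "integrable M (\<lambda>w. indicator {i} (y w) *\<^sub>R x w)"
  "integrable M (\<lambda>w. indicator {i} (y w) * (norm (x w))\<^sup>2)"
proof -
  show "integrable M (\<lambda>w. indicator {i} (y w) :: real)"
    by (rule integrable_const_bound[where B = 1]) (auto simp: indicator_def)
  show "integrable M (\<lambda>w. indicator {i} (y w) *\<^sub>R x w)"
    by (rule Bochner_Integration.integrable_bound[OF x_int]) (auto simp: indicator_def)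
  show "integrable M (\<lambda>w. indicator {i} (y w) * (norm (x w))\<^sup>2)"
    by (rule Bochner_Integration.integrable_bound[OF sq_int]) (auto simp: indicator_def)
qed

lemma cell_mass_nonneg: "0 \<le> cell_mass M y i"
  by (simp add: cell_mass_def)

lemma cell_null:
  assumes "cell_mass M y i = 0"
  shows "cell_moment M x y i = 0" "cell_energy M x y i = 0"
proof -
  have "AE w in M. indicator {i} (y w) = (0::real)"
    using assms integral_nonneg_eq_0_iff_AE[OF cell_int(1)[of i]] by (simp add: cell_mass_def)
  then show "cell_moment M x y i = 0" "cell_energy M x y i = 0"
    unfolding cell_moment_def cell_energy_def
    by (auto intro!: integral_eq_zero_AE)
qed

text \<open>
  The variance of \<open>x\<close> on a cell is non-negative. The bound makes the contribution of a cell to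
  \<open>quantized_moment\<close> vanish when the cell shrinks to a null set, where the quotient by the mass is not
  continuous.
\<close>

lemma norm_cell_moment_le:
  "(norm (cell_moment M x y i))\<^sup>2 / cell_mass M y i \<le> cell_energy M x y i"
proof (cases "cell_mass M y i = 0")
  case True
  then show ?thesis by (simp add: cell_null)
next
  case False
  then have p: "cell_mass M y i > 0" using cell_mass_nonneg[of i] by simp
  define b where "b = cell_moment M x y i"
  define c where "c = b /\<^sub>R cell_mass M y i"
  have "0 \<le> (\<integral>w. indicator {i} (y w) * (norm (x w - c))\<^sup>2 \<partial>M)"
    by simp
  also have "\<dots> = (\<integral>w. indicator {i} (y w) * (norm (x w))\<^sup>2
      - 2 * ((indicator {i} (y w) *\<^sub>R x w) \<bullet> c) + indicator {i} (y w) * (norm c)\<^sup>2 \<partial>M)"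
    by (intro Bochner_Integration.integral_cong)
       (auto simp: indicator_def power2_norm_eq_inner inner_diff inner_commute)
  also have "\<dots> = cell_energy M x y i - 2 * (b \<bullet> c) + cell_mass M y i * (norm c)\<^sup>2"
    using cell_int[of i]
    by (simp add: cell_mass_def cell_energy_def cell_moment_def b_def del: inner_scaleR_left)
  also have "\<dots> = cell_energy M x y i - (norm b)\<^sup>2 / cell_mass M y i"
    using p by (simp add: c_def power2_norm_eq_inner power2_eq_square[of "cell_mass M y i"] field_simps)
  finally show ?thesis by (simp add: b_def)
qed

lemma cell_energy_le: "cell_energy M x y i \<le> (\<integral>w. (norm (x w))\<^sup>2 \<partial>M)"
  unfolding cell_energy_def
  by (intro integral_mono cell_int sq_int) (auto simp: indicator_def)

lemma integral_affine_label:
  shows "integrable M (\<lambda>w. \<alpha> (y w) + \<beta> (y w) \<bullet> x w)"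
    and "(\<integral>w. \<alpha> (y w) + \<beta> (y w) \<bullet> x w \<partial>M) =
      (\<Sum>i\<in>{1..n}. \<alpha> i * cell_mass M y i + \<beta> i \<bullet> cell_moment M x y i)"
proof -
  have eq: "\<alpha> (y w) + \<beta> (y w) \<bullet> x w =
      (\<Sum>i\<in>{1..n}. \<alpha> i * indicator {i} (y w) + \<beta> i \<bullet> (indicator {i} (y w) *\<^sub>R x w))"
    if "w \<in> space M" for w
  proof -
    have "(\<Sum>i\<in>{1..n}. \<alpha> i * indicator {i} (y w) + \<beta> i \<bullet> (indicator {i} (y w) *\<^sub>R x w))
      = (\<Sum>i\<in>{1..n}. if i = y w then \<alpha> i + \<beta> i \<bullet> x w else 0)"
      by (intro sum.cong) (auto simp: indicator_def)
    then show ?thesis using y_range[OF that] by simp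
  qed
  have int: "integrable M (\<lambda>w. \<Sum>i\<in>{1..n}. \<alpha> i * indicator {i} (y w) + \<beta> i \<bullet> (indicator {i} (y w) *\<^sub>R x w))"
    by (intro Bochner_Integration.integrable_sum Bochner_Integration.integrable_add
      integrable_mult_right integrable_inner_right cell_int)
  then show "integrable M (\<lambda>w. \<alpha> (y w) + \<beta> (y w) \<bullet> x w)"
    by (subst Bochner_Integration.integrable_cong[OF refl eq]) auto
  show "(\<integral>w. \<alpha> (y w) + \<beta> (y w) \<bullet> x w \<partial>M) =
      (\<Sum>i\<in>{1..n}. \<alpha> i * cell_mass M y i + \<beta> i \<bullet> cell_moment M x y i)"
    apply (subst Bochner_Integration.integral_cong[OF refl eq], assumption)
    using cell_int by (simp add: cell_mass_def cell_moment_def Bochner_Integration.integral_sum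
      Bochner_Integration.integral_add del: inner_scaleR_right)
qed

lemma norm_quantized_moment_le:
  "norm (quantized_moment M x y n) \<le> real n * (\<integral>w. (norm (x w))\<^sup>2 \<partial>M)"
proof -
  have "norm ((1 / cell_mass M y i) *\<^sub>R outer (cell_moment M x y i)) \<le> (\<integral>w. (norm (x w))\<^sup>2 \<partial>M)" for i
    using norm_cell_moment_le[of i] cell_energy_le[of i] cell_mass_nonneg[of i]
    by (simp add: norm_outer)
  then have "norm (quantized_moment M x y n) \<le> (\<Sum>i\<in>{1..n}. \<integral>w. (norm (x w))\<^sup>2 \<partial>M)"
    unfolding quantized_moment_def by (intro sum_norm_le)
  then show ?thesis by simp
qed

text \<open>
  Dominated convergence gives convergence of masses and moments. Cells that become null in the limit
  are controlled by their energy instead, which tends to zero.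
\<close>

lemma tendsto_quantized_moment:
  assumes Y: "\<And>k. labelled_sample M x (Y k) n"
    and ev: "\<And>w. w \<in> space M \<Longrightarrow> \<forall>\<^sub>F k in sequentially. Y k w = y w"
  shows "(\<lambda>k. quantized_moment M x (Y k) n) \<longlonglongrightarrow> quantized_moment M x y n"
proof -
  have [measurable]: "Y k \<in> M \<rightarrow>\<^sub>M count_space UNIV" for k
    using Y by (rule labelled_sample.y_meas)
  have ind: "(\<lambda>k. indicator {i} (Y k w) :: real) \<longlonglongrightarrow> indicator {i} (y w)" if "w \<in> space M" for i w
    by (rule tendsto_eventually, use ev[OF that] in eventually_elim) simp
  have mass: "(\<lambda>k. cell_mass M (Y k) i) \<longlonglongrightarrow> cell_mass M y i" for i
    unfolding cell_mass_def
    by (rule integral_dominated_convergence[where w = "\<lambda>_. 1"])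
       (use ind in \<open>auto simp: indicator_def\<close>)
  have moment: "(\<lambda>k. cell_moment M x (Y k) i) \<longlonglongrightarrow> cell_moment M x y i" for i
    unfolding cell_moment_def
  proof (rule integral_dominated_convergence[where w = "\<lambda>w. norm (x w)"])
    show "AE w in M. (\<lambda>k. indicator {i} (Y k w) *\<^sub>R x w) \<longlonglongrightarrow> indicator {i} (y w) *\<^sub>R x w"
      by (intro AE_I2 tendsto_intros ind)
    show "AE w in M. norm (indicator {i} (Y k w) *\<^sub>R x w) \<le> norm (x w)" for k
      by (simp add: indicator_def)
    show "(\<lambda>w. indicator {i} (Y k w) *\<^sub>R x w) \<in> borel_measurable M" for k
      using labelled_sample.cell_int(2)[OF Y] by (rule borel_measurable_integrable)
  qed (use x_int cell_int(2)[of i] in auto)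
  have energy: "(\<lambda>k. cell_energy M x (Y k) i) \<longlonglongrightarrow> cell_energy M x y i" for i
    unfolding cell_energy_def
  proof (rule integral_dominated_convergence[where w = "\<lambda>w. (norm (x w))\<^sup>2"])
    show "AE w in M. (\<lambda>k. indicator {i} (Y k w) * (norm (x w))\<^sup>2) \<longlonglongrightarrow> indicator {i} (y w) * (norm (x w))\<^sup>2"
      by (intro AE_I2 tendsto_intros ind)
    show "AE w in M. norm (indicator {i} (Y k w) * (norm (x w))\<^sup>2) \<le> (norm (x w))\<^sup>2" for k
      by (simp add: indicator_def)
    show "(\<lambda>w. indicator {i} (Y k w) * (norm (x w))\<^sup>2) \<in> borel_measurable M" for k
      using labelled_sample.cell_int(3)[OF Y] by (rule borel_measurable_integrable)
  qed (use sq_int cell_int(3)[of i] in auto)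
  have "(\<lambda>k. (1 / cell_mass M (Y k) i) *\<^sub>R outer (cell_moment M x (Y k) i))
      \<longlonglongrightarrow> (1 / cell_mass M y i) *\<^sub>R outer (cell_moment M x y i)" for i
  proof (cases "cell_mass M y i = 0")
    case False
    moreover have "(\<lambda>k. outer (cell_moment M x (Y k) i)) \<longlonglongrightarrow> outer (cell_moment M x y i)"
      using continuous_on_tendsto_compose[OF continuous_outer moment] by simp
    ultimately show ?thesis
      using mass by (intro tendsto_intros)
  next
    case True
    have "(\<lambda>k. (1 / cell_mass M (Y k) i) *\<^sub>R outer (cell_moment M x (Y k) i)) \<longlonglongrightarrow> 0"
    proof (rule Lim_null_comparison)
      show "\<forall>\<^sub>F k in sequentially. norm ((1 / cell_mass M (Y k) i) *\<^sub>R outer (cell_moment M x (Y k) i))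
          \<le> cell_energy M x (Y k) i"
        using labelled_sample.norm_cell_moment_le[OF Y] labelled_sample.cell_mass_nonneg[OF Y]
        by (simp add: norm_outer)
      show "(\<lambda>k. cell_energy M x (Y k) i) \<longlonglongrightarrow> 0"
        using energy[of i] cell_null[OF True] by simp
    qed
    then show ?thesis by (simp add: True)
  qed
  then show ?thesis
    unfolding quantized_moment_def by (intro tendsto_sum)
qed

section \<open>Distortion of a labelling\<close>

lemma norm_quantized_moment_sq:
  "(norm (quantized_moment M x y n))\<^sup>2 =
     (\<Sum>i\<in>{1..n}. \<Sum>j\<in>{1..n}. (cell_moment M x y i \<bullet> cell_moment M x y j)\<^sup>2
        / (cell_mass M y i * cell_mass M y j))"
  unfolding quantized_moment_def power2_norm_eq_inner inner_sum_left
  unfolding inner_sum_right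
  by (intro sum.cong refl) (simp add: inner_outer)

lemma integral_gauge_difference_expand:
  "(\<integral>(w, w'). \<bar>x w \<bullet> x w' - G (y w) (y w')\<bar>\<^sup>2 \<partial>(M \<Otimes>\<^sub>M M)) =
     (norm (\<integral>w. outer (x w) \<partial>M))\<^sup>2
     + (\<Sum>i\<in>{1..n}. \<Sum>j\<in>{1..n}. (G i j)\<^sup>2 * (cell_mass M y i * cell_mass M y j)
          - 2 * G i j * (cell_moment M x y i \<bullet> cell_moment M x y j))"
proof -
  let ?e = "\<lambda>i w. indicator {i} (y w) :: real"
  have int_outer: "integrable M (\<lambda>w. outer (x w))"
    by (rule Bochner_Integration.integrable_bound[OF sq_int]) (auto simp: norm_outer)
  note quad = integrable_inner_pair[OF prob_space_axioms int_outer int_outer]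
  note cross = integrable_inner_pair[OF prob_space_axioms cell_int(2) cell_int(2)]
  note const = integrable_inner_pair[OF prob_space_axioms cell_int(1) cell_int(1)]
  have "(\<integral>(w, w'). \<bar>x w \<bullet> x w' - G (y w) (y w')\<bar>\<^sup>2 \<partial>(M \<Otimes>\<^sub>M M)) =
    (\<integral>z. (case z of (w, w') \<Rightarrow> outer (x w) \<bullet> outer (x w')) +
      (\<Sum>i\<in>{1..n}. \<Sum>j\<in>{1..n}. (G i j)\<^sup>2 * (case z of (w, w') \<Rightarrow> ?e i w \<bullet> ?e j w')
        - 2 * G i j * (case z of (w, w') \<Rightarrow> (?e i w *\<^sub>R x w) \<bullet> (?e j w' *\<^sub>R x w'))) \<partial>(M \<Otimes>\<^sub>M M))"
  proof (rule Bochner_Integration.integral_cong[OF refl])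
    fix z assume "z \<in> space (M \<Otimes>\<^sub>M M)"
    then obtain w w' where z: "z = (w, w')" and w: "w \<in> space M" "w' \<in> space M"
      by (auto simp: space_pair_measure)
    let ?h = "\<lambda>i j. (G i j)\<^sup>2 - 2 * G i j * (x w \<bullet> x w')"
    have "(G i j)\<^sup>2 * (?e i w \<bullet> ?e j w') - 2 * G i j * ((?e i w *\<^sub>R x w) \<bullet> (?e j w' *\<^sub>R x w'))
      = (if j = y w' then if i = y w then ?h i j else 0 else 0)" for i j
      by (auto simp: indicator_def)
    then have "(\<Sum>i\<in>{1..n}. \<Sum>j\<in>{1..n}. (G i j)\<^sup>2 * (?e i w \<bullet> ?e j w')
        - 2 * G i j * ((?e i w *\<^sub>R x w) \<bullet> (?e j w' *\<^sub>R x w')))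
      = (\<Sum>i\<in>{1..n}. \<Sum>j\<in>{1..n}. if j = y w' then if i = y w then ?h i j else 0 else 0)"
      by (simp only:)
    also have "\<dots> = ?h (y w) (y w')"
      using y_range[OF w(1)] y_range[OF w(2)] by (simp del: atLeastAtMost_iff)
    finally show "(case z of (w, w') \<Rightarrow> \<bar>x w \<bullet> x w' - G (y w) (y w')\<bar>\<^sup>2) =
        (case z of (w, w') \<Rightarrow> outer (x w) \<bullet> outer (x w')) +
      (\<Sum>i\<in>{1..n}. \<Sum>j\<in>{1..n}. (G i j)\<^sup>2 * (case z of (w, w') \<Rightarrow> ?e i w \<bullet> ?e j w')
        - 2 * G i j * (case z of (w, w') \<Rightarrow> (?e i w *\<^sub>R x w) \<bullet> (?e j w' *\<^sub>R x w')))"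
      by (simp add: z inner_outer power2_diff del: inner_real_def inner_scaleR_left inner_scaleR_right)
  qed
  also have "\<dots> = (norm (\<integral>w. outer (x w) \<partial>M))\<^sup>2
     + (\<Sum>i\<in>{1..n}. \<Sum>j\<in>{1..n}. (G i j)\<^sup>2 * (cell_mass M y i \<bullet> cell_mass M y j)
          - 2 * G i j * (cell_moment M x y i \<bullet> cell_moment M x y j))"
    using quad cross const
    by (simp add: Bochner_Integration.integral_add Bochner_Integration.integral_sum
        Bochner_Integration.integral_diff power2_norm_eq_inner cell_mass_def cell_moment_def
        del: inner_real_def inner_scaleR_left inner_scaleR_right)
  finally show ?thesis by simp
qed

text \<open>
  Completing the square in \<open>G\<close>, entry by entry: the optimal entries are the scalar products of the cell
  means, and what they save is \<open>\<parallel>quantized_moment\<parallel>\<^sup>2\<close>.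
\<close>

lemma integral_gauge_difference:
  "(\<integral>(w, w'). \<bar>x w \<bullet> x w' - G (y w) (y w')\<bar>\<^sup>2 \<partial>(M \<Otimes>\<^sub>M M)) =
     (norm (\<integral>w. outer (x w) \<partial>M))\<^sup>2 - (norm (quantized_moment M x y n))\<^sup>2
     + (\<Sum>i\<in>{1..n}. \<Sum>j\<in>{1..n}. cell_mass M y i * cell_mass M y j *
          (G i j - (cell_moment M x y i \<bullet> cell_moment M x y j)
             / (cell_mass M y i * cell_mass M y j))\<^sup>2)"
proof -
  have "(G i j)\<^sup>2 * (cell_mass M y i * cell_mass M y j)
          - 2 * G i j * (cell_moment M x y i \<bullet> cell_moment M x y j) =
      cell_mass M y i * cell_mass M y j *
          (G i j - (cell_moment M x y i \<bullet> cell_moment M x y j)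
             / (cell_mass M y i * cell_mass M y j))\<^sup>2
      - (cell_moment M x y i \<bullet> cell_moment M x y j)\<^sup>2 / (cell_mass M y i * cell_mass M y j)" for i j
  proof (cases "cell_mass M y i * cell_mass M y j = 0")
    case True
    then show ?thesis using cell_null(1)[of i] cell_null(1)[of j] by auto
  next
    case False
    then show ?thesis
      by (simp add: power2_diff power_divide divide_simps) (simp add: power2_eq_square algebra_simps)
  qed
  then show ?thesis
    unfolding integral_gauge_difference_expand norm_quantized_moment_sq
    by (simp only: sum_subtractf)
qed

end

section \<open>Convergent subsequences of half-spaces\<close>

text \<open>
  Induction on the dimension of \<open>S\<close>. Project \<open>\<theta> k\<close> to \<open>S\<close> and normalise: along a subsequence the
  directions converge to some unit vector \<open>l \<in> S\<close>. Points with \<open>l \<bullet> y \<noteq> 0\<close> then see a constant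
  sign eventually, and the remaining ones lie in the smaller subspace \<open>{y \<in> S. l \<bullet> y = 0}\<close>. The case
  \<open>S = UNIV\<close> is the one of interest.
\<close>

lemma exists_subseq_eventually_signed_on_subspace:
  fixes \<theta> :: "nat \<Rightarrow> 'a::euclidean_space"
  assumes "subspace S"
  shows "\<exists>r. strict_mono r \<and> (\<forall>y\<in>S. (\<forall>\<^sub>F k in sequentially. 0 \<le> \<theta> (r k) \<bullet> y) \<or>
                                   (\<forall>\<^sub>F k in sequentially. \<theta> (r k) \<bullet> y < 0))"
  using assms
proof (induction "dim S" arbitrary: S \<theta> rule: less_induct)
  case less
  have "\<exists>p v. p \<in> span S \<and> (\<forall>w\<in>span S. orthogonal v w) \<and> \<theta> k = p + v" for k
    by (metis orthogonal_subspace_decomp_exists)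
  then obtain p v where "\<And>k. p k \<in> span S" "\<And>k w. w \<in> span S \<Longrightarrow> orthogonal (v k) w"
    "\<And>k. \<theta> k = p k + v k" by metis
  then have p: "p k \<in> S" "\<And>y. y \<in> S \<Longrightarrow> \<theta> k \<bullet> y = p k \<bullet> y" for k
    using less.prems by (auto simp: span_eq_iff[THEN iffD2] inner_add_left orthogonal_def)
  \<comment> \<open>If the projections vanish infinitely often, there is no direction to normalise, but on \<open>S\<close>
      the sign along these indices is constantly zero.\<close>
  show ?case
  proof (cases "\<exists>\<^sub>F k in sequentially. p k = 0")
    case True
    then have "infinite {k. p k = 0}"
      by (simp add: frequently_cofinite cofinite_eq_sequentially[symmetric])
    then have "strict_mono (enumerate {k. p k = 0})" "\<And>k. p (enumerate {k. p k = 0} k) = 0"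
      using enumerate_in_set[of "{k. p k = 0}"] by (auto simp: strict_mono_enumerate)
    then show ?thesis using p by (intro exI[of _ "enumerate {k. p k = 0}"]) auto
  next
    case False
    then have nz: "\<forall>\<^sub>F k in sequentially. p k \<noteq> 0"
      by (simp add: frequently_def)
    then obtain N where N: "\<And>k. k \<ge> N \<Longrightarrow> p k \<noteq> 0"
      by (auto simp: eventually_sequentially)
    \<comment> \<open>The shift by \<open>N\<close> keeps the normalised vectors on the unit sphere.\<close>
    define u where "u k = p (k + N) /\<^sub>R norm (p (k + N))" for k
    have u: "u k \<in> S \<inter> sphere 0 1" for k
      using N[of "k + N"] p(1) less.prems by (simp add: u_def subspace_scale)
    have "compact (S \<inter> sphere 0 1)"
      by (intro closed_Int_compact closed_subspace less.prems compact_sphere)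
    then obtain l s where l: "l \<in> S \<inter> sphere 0 1" and s: "strict_mono s" "(u \<circ> s) \<longlonglongrightarrow> l"
      using u unfolding compact_def by metis
    define t where "t k = s k + N" for k
    have t: "strict_mono t" using s by (simp add: t_def strict_mono_def)
    define S' where "S' = S \<inter> {y. l \<bullet> y = 0}"
    have S': "subspace S'"
      unfolding S'_def by (intro subspace_inter less.prems subspace_hyperplane)
    have "l \<in> S" "l \<notin> S'" using l by (auto simp: S'_def dist_norm)
    then have "S' \<subset> S" unfolding S'_def by blast
    then have "dim S' < dim S"
      using dim_psubset S' less.prems by (metis span_eq_iff)
    from less.hyps[OF this S', of "\<theta> \<circ> t"] obtain q where q: "strict_mono q"
      "\<And>y. y \<in> S' \<Longrightarrow> (\<forall>\<^sub>F k in sequentially. 0 \<le> \<theta> (t (q k)) \<bullet> y) \<or>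
            (\<forall>\<^sub>F k in sequentially. \<theta> (t (q k)) \<bullet> y < 0)"
      by auto
    have lim: "(\<lambda>k. u (s (q k)) \<bullet> y) \<longlonglongrightarrow> l \<bullet> y" for y
      using LIMSEQ_subseq_LIMSEQ[OF s(2) q(1)] by (intro tendsto_intros) (simp add: o_def)
    have sgn: "\<theta> (t (q k)) \<bullet> y = norm (p (t (q k))) * (u (s (q k)) \<bullet> y)"
      "norm (p (t (q k))) > 0" if "y \<in> S" for k y
      using p(2)[OF that] N[of "t (q k)"] by (auto simp: u_def t_def)
    have "(\<forall>\<^sub>F k in sequentially. 0 \<le> \<theta> (t (q k)) \<bullet> y) \<or>
            (\<forall>\<^sub>F k in sequentially. \<theta> (t (q k)) \<bullet> y < 0)" if y: "y \<in> S" for y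
    proof (cases "l \<bullet> y" "0::real" rule: linorder_cases)
      case less
      then have "\<forall>\<^sub>F k in sequentially. u (s (q k)) \<bullet> y < 0"
        using order_tendstoD(2)[OF lim] by blast
      then show ?thesis using sgn[OF y] by (simp add: mult_less_0_iff)
    next
      case equal
      then show ?thesis using y q(2) by (simp add: S'_def)
    next
      case greater
      then have "\<forall>\<^sub>F k in sequentially. u (s (q k)) \<bullet> y > 0"
        using order_tendstoD(1)[OF lim] by blast
      then have "\<forall>\<^sub>F k in sequentially. 0 \<le> \<theta> (t (q k)) \<bullet> y"
        by (rule eventually_mono) (simp add: sgn[OF y])
      then show ?thesis by simp
    qed
    then show ?thesis
      using strict_mono_o[OF t q(1)] by (intro exI[of _ "t \<circ> q"]) auto
  qed
qed

lemma exists_subseq_eventually_signed: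
  fixes \<theta> :: "nat \<Rightarrow> 'i \<Rightarrow> 'a::euclidean_space"
  assumes "finite I"
  shows "\<exists>r. strict_mono r \<and> (\<forall>i\<in>I. \<forall>y. (\<forall>\<^sub>F k in sequentially. 0 \<le> \<theta> (r k) i \<bullet> y) \<or>
                                   (\<forall>\<^sub>F k in sequentially. \<theta> (r k) i \<bullet> y < 0))"
  using assms
proof induction
  case empty
  show ?case by (intro exI[of _ id]) (auto simp: strict_mono_def)
next
  case (insert i I)
  then obtain r where r: "strict_mono r" "\<And>j y. j \<in> I \<Longrightarrow> (\<forall>\<^sub>F k in sequentially. 0 \<le> \<theta> (r k) j \<bullet> y) \<or>
                                   (\<forall>\<^sub>F k in sequentially. \<theta> (r k) j \<bullet> y < 0)" by blast
  obtain s where s: "strict_mono s" "\<And>y. (\<forall>\<^sub>F k in sequentially. 0 \<le> \<theta> (r (s k)) i \<bullet> y) \<or>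
                                   (\<forall>\<^sub>F k in sequentially. \<theta> (r (s k)) i \<bullet> y < 0)"
    using exists_subseq_eventually_signed_on_subspace[OF subspace_UNIV, of "\<lambda>k. \<theta> (r k) i"] by auto
  have "(\<forall>\<^sub>F k in sequentially. 0 \<le> \<theta> (r (s k)) j \<bullet> y) \<or>
                                   (\<forall>\<^sub>F k in sequentially. \<theta> (r (s k)) j \<bullet> y < 0)" if "j \<in> I" for j y
    using r(2)[OF that, of y] eventually_subseq[OF s(1)] by blast
  then show ?case
    using s strict_mono_o[OF r(1) s(1)] by (intro exI[of _ "\<lambda>k. r (s k)"]) (auto simp: o_def)
qed

section \<open>Labels given by affine functions\<close>

text \<open>
  The pair \<open>(\<alpha>, \<beta>)\<close> stands for the affine function \<open>(\<alpha>, \<beta>) \<bullet> (1, x) = \<alpha> + \<beta> \<bullet> x\<close>. The label is the first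
  index whose function is maximal at \<open>x\<close>. It is written by means of the signs of the differences
  \<open>\<theta> i - \<theta> j\<close> at \<open>(1, x)\<close>, because these stabilise along subsequences.
\<close>

definition affine_label :: "nat \<Rightarrow> (nat \<Rightarrow> real \<times> (real ^ 'd)) \<Rightarrow> real ^ 'd \<Rightarrow> nat" where
  "affine_label n \<theta> x =
     (LEAST i. i \<in> {1..n} \<and> (\<forall>j\<in>{1..n}. 0 \<le> (\<theta> i - \<theta> j) \<bullet> (1, x)))"

lemma affine_label_maximal:
  assumes "n \<ge> 1"
  shows "affine_label n \<theta> x \<in> {1..n}"
    and "j \<in> {1..n} \<Longrightarrow> \<theta> j \<bullet> (1, x) \<le> \<theta> (affine_label n \<theta> x) \<bullet> (1, x)"
proof -
  let ?S = "(\<lambda>i. \<theta> i \<bullet> (1, x)) ` {1..n}"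
  have "Max ?S \<in> ?S" using assms by (intro Max_in) auto
  then obtain i where "i \<in> {1..n}" "\<theta> i \<bullet> (1, x) = Max ?S" by auto
  then have "i \<in> {1..n} \<and> (\<forall>j\<in>{1..n}. 0 \<le> (\<theta> i - \<theta> j) \<bullet> (1, x))"
    by (auto simp: inner_diff_left)
  then have "affine_label n \<theta> x \<in> {1..n} \<and>
      (\<forall>j\<in>{1..n}. 0 \<le> (\<theta> (affine_label n \<theta> x) - \<theta> j) \<bullet> (1, x))"
    unfolding affine_label_def by (rule LeastI)
  then show "affine_label n \<theta> x \<in> {1..n}"
    and "j \<in> {1..n} \<Longrightarrow> \<theta> j \<bullet> (1, x) \<le> \<theta> (affine_label n \<theta> x) \<bullet> (1, x)"
    by (auto simp: inner_diff_left)
qed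

lemma labelled_sample_affine_label:
  fixes \<xi> :: "(real ^ 'd) measure"
  assumes "prob_space \<xi>" and [measurable]: "(\<lambda>x. x) \<in> borel_measurable \<xi>"
    and "integrable \<xi> (\<lambda>x. (norm x)\<^sup>2)" and "n \<ge> 1"
  shows "labelled_sample \<xi> (\<lambda>x. x) (affine_label n \<theta>) n"
proof -
  have [measurable]: "(\<lambda>x. (1 :: real, x)) \<in> borel_measurable \<xi>"
    by (intro borel_measurable_Pair) auto
  have "affine_label n \<theta> \<in> \<xi> \<rightarrow>\<^sub>M count_space UNIV"
    unfolding affine_label_def by measurable
  then show ?thesis
    using assms affine_label_maximal(1)[OF assms(4)]
    by (auto simp: labelled_sample_def labelled_sample_axioms_def)
qed

text \<open>
  Take parameters \<open>\<theta> k\<close> whose values approach the supremum and pass to a subsequence along which, at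
  every point, the sign of \<open>\<theta> k i - \<theta> k j\<close> stabilises for all pairs \<open>i, j\<close>. Then the labels stabilise
  pointwise as well. The limit \<open>T\<close> attains the supremum, although it breaks ties between affine functions
  in a way that depends on the whole sequence and need not itself be an \<open>affine_label\<close>.
\<close>

lemma exists_label_dominating_affine_labels:
  fixes \<xi> :: "(real ^ 'd) measure"
  assumes "prob_space \<xi>" and [measurable]: "(\<lambda>x. x) \<in> borel_measurable \<xi>"
    and "integrable \<xi> (\<lambda>x. (norm x)\<^sup>2)" and "n \<ge> 1"
  obtains T where "labelled_sample \<xi> (\<lambda>x. x) T n"
    and "\<And>\<theta>. norm (quantized_moment \<xi> (\<lambda>x. x) (affine_label n \<theta>) n)
           \<le> norm (quantized_moment \<xi> (\<lambda>x. x) T n)"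
proof -
  note sample = labelled_sample_affine_label[OF assms]
  define F where "F \<theta> = norm (quantized_moment \<xi> (\<lambda>x. x) (affine_label n \<theta>) n)" for \<theta>
  have bdd: "bdd_above (range F)"
    using labelled_sample.norm_quantized_moment_le[OF sample] unfolding F_def
    by (intro bdd_aboveI2)
  then have "Sup (range F) \<in> closure (range F)"
    by (intro closure_contains_Sup) auto
  then obtain f where "\<And>k. f k \<in> range F" and f: "f \<longlonglongrightarrow> Sup (range F)"
    unfolding closure_sequential by blast
  then have "\<exists>\<theta>. \<forall>k. f k = F (\<theta> k)" by (intro choice) auto
  then obtain \<theta> where \<theta>: "\<And>k. f k = F (\<theta> k)" by blast
  define \<delta> where "\<delta> k = (\<lambda>(i, j). \<theta> k i - \<theta> k j)" for k
  obtain r where r: "strict_mono r"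
    and \<delta>: "\<And>p z. p \<in> {1..n} \<times> {1..n} \<Longrightarrow> (\<forall>\<^sub>F k in sequentially. 0 \<le> \<delta> (r k) p \<bullet> z) \<or>
            (\<forall>\<^sub>F k in sequentially. \<delta> (r k) p \<bullet> z < 0)"
    using exists_subseq_eventually_signed[of "{1..n} \<times> {1..n}" \<delta>] by auto
  have sgn: "(\<forall>\<^sub>F k in sequentially. 0 \<le> (\<theta> (r k) i - \<theta> (r k) j) \<bullet> z) \<or>
            (\<forall>\<^sub>F k in sequentially. (\<theta> (r k) i - \<theta> (r k) j) \<bullet> z < 0)"
    if "i \<in> {1..n}" "j \<in> {1..n}" for i j z
    using \<delta>[of "(i, j)" z] that by (simp add: \<delta>_def)
  define T where "T x = (LEAST i. i \<in> {1..n} \<and>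
      (\<forall>j\<in>{1..n}. \<forall>\<^sub>F k in sequentially. 0 \<le> (\<theta> (r k) i - \<theta> (r k) j) \<bullet> (1, x)))" for x
  have ev: "\<forall>\<^sub>F k in sequentially. affine_label n (\<theta> (r k)) x = T x" for x
  proof -
    have "\<forall>\<^sub>F k in sequentially. 0 \<le> (\<theta> (r k) i - \<theta> (r k) j) \<bullet> (1, x) \<longleftrightarrow>
        (\<forall>\<^sub>F k in sequentially. 0 \<le> (\<theta> (r k) i - \<theta> (r k) j) \<bullet> (1, x))"
      if "i \<in> {1..n}" "j \<in> {1..n}" for i j
      using sgn[OF that, of "(1, x)"]
    proof
      assume "\<forall>\<^sub>F k in sequentially. 0 \<le> (\<theta> (r k) i - \<theta> (r k) j) \<bullet> (1, x)"
      then show ?thesis by simp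
    next
      assume neg: "\<forall>\<^sub>F k in sequentially. (\<theta> (r k) i - \<theta> (r k) j) \<bullet> (1, x) < 0"
      have "\<not> (\<forall>\<^sub>F k in sequentially. 0 \<le> (\<theta> (r k) i - \<theta> (r k) j) \<bullet> (1, x))"
      proof
        assume "\<forall>\<^sub>F k in sequentially. 0 \<le> (\<theta> (r k) i - \<theta> (r k) j) \<bullet> (1, x)"
        with neg have "\<forall>\<^sub>F k::nat in sequentially. False"
          by eventually_elim simp
        then show False by simp
      qed
      with neg show ?thesis by (auto elim: eventually_mono)
    qed
    then have "\<forall>\<^sub>F k in sequentially. \<forall>i\<in>{1..n}. \<forall>j\<in>{1..n}.
        0 \<le> (\<theta> (r k) i - \<theta> (r k) j) \<bullet> (1, x) \<longleftrightarrow>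
        (\<forall>\<^sub>F k in sequentially. 0 \<le> (\<theta> (r k) i - \<theta> (r k) j) \<bullet> (1, x))"
      by (intro eventually_ball_finite finite_atLeastAtMost ballI)
    then show ?thesis
    proof eventually_elim
      case (elim k)
      then show ?case
        unfolding affine_label_def T_def by (intro arg_cong[where f = Least] ext) blast
    qed
  qed
  have range: "T x \<in> {1..n}" for x
  proof -
    obtain k where "affine_label n (\<theta> (r k)) x = T x"
      using eventually_happens[OF ev] by auto
    then show ?thesis using affine_label_maximal(1)[OF assms(4)] by metis
  qed
  have [measurable]: "(\<lambda>x. (1 :: real, x)) \<in> borel_measurable \<xi>"
    by (intro borel_measurable_Pair) auto
  have "T \<in> \<xi> \<rightarrow>\<^sub>M count_space UNIV"
    unfolding T_def eventually_sequentially by measurable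
  then have T: "labelled_sample \<xi> (\<lambda>x. x) T n"
    using assms range by (auto simp: labelled_sample_def labelled_sample_axioms_def)
  have "(\<lambda>k. F (\<theta> (r k))) \<longlonglongrightarrow> norm (quantized_moment \<xi> (\<lambda>x. x) T n)"
    unfolding F_def
    by (intro tendsto_norm labelled_sample.tendsto_quantized_moment[OF T] sample ev)
  moreover have "(\<lambda>k. F (\<theta> (r k))) \<longlonglongrightarrow> Sup (range F)"
    using LIMSEQ_subseq_LIMSEQ[OF f r] by (simp add: o_def \<theta>)
  ultimately have "norm (quantized_moment \<xi> (\<lambda>x. x) T n) = Sup (range F)"
    by (rule LIMSEQ_unique)
  then have "F \<theta>' \<le> norm (quantized_moment \<xi> (\<lambda>x. x) T n)" for \<theta>'
    using bdd by (simp add: cSup_upper)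
  then show ?thesis using that T unfolding F_def by blast
qed

text \<open>
  Write \<open>A\<close> for the quantized moment of the given labelling, \<open>q u v = u\<^sup>T A v\<close>, and \<open>c i\<close> for its cell
  means. As \<open>q\<close> is positive semidefinite, \<open>q e e / s \<ge> 2 q (c i) e - s q (c i) (c i)\<close> for every mass \<open>s\<close> and
  moment \<open>e\<close>, with equality at the cells of the given labelling itself. The right-hand side, summed over
  the cells of any labelling, is the integral of the functions \<open>2 q (c i) x - q (c i) (c i)\<close>, which are
  affine in \<open>x\<close>. Choosing at each \<open>x\<close> the label with the largest of them yields a quantized moment \<open>B\<close>
  with \<open>A \<bullet> A \<le> A \<bullet> B\<close>, and Cauchy--Schwarz concludes.
\<close>

lemma (in labelled_sample) exists_affine_label_improvement:
  fixes \<xi> :: "(real ^ 'd) measure"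
  assumes x\<xi>: "x \<in> M \<rightarrow>\<^sub>M \<xi>" and marg: "distr M \<xi> x = \<xi>"
    and id_meas: "(\<lambda>x. x) \<in> borel_measurable \<xi>" and "n \<ge> 1"
  obtains \<theta> where "norm (quantized_moment M x y n)
     \<le> norm (quantized_moment \<xi> (\<lambda>x. x) (affine_label n \<theta>) n)"
proof -
  define p where "p = cell_mass M y"
  define b where "b = cell_moment M x y"
  define q where "q u v = (\<Sum>j\<in>{1..n}. (1 / p j) * ((b j \<bullet> u) * (b j \<bullet> v)))" for u v
  define c where "c i = b i /\<^sub>R p i" for i
  have p_nonneg: "p j \<ge> 0" for j by (simp add: p_def cell_mass_nonneg)
  have b0: "b i = 0" if "p i = 0" for i using that cell_null by (simp add: p_def b_def)
  have q_nonneg: "0 \<le> q u u" for u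
    unfolding q_def by (intro sum_nonneg) (simp add: p_nonneg)
  have q_scale: "q (s *\<^sub>R u) v = s * q u v" "q u (s *\<^sub>R v) = s * q u v" for s u v
    by (simp_all add: q_def sum_distrib_left algebra_simps)
  have q_zero: "q 0 v = 0" "q u 0 = 0" for u v
    by (simp_all add: q_def)
  have q_diff: "q (u - v) (u - v) = q u u - 2 * q v u + q v v" for u v
    by (simp add: q_def sum_distrib_left flip: sum.distrib sum_subtractf)
       (intro sum.cong refl, simp add: inner_diff_right algebra_simps add_divide_distrib diff_divide_distrib)
  define \<alpha> where "\<alpha> i = - q (c i) (c i)" for i
  define \<beta> where "\<beta> i = (\<Sum>j\<in>{1..n}. (2 / p j * (b j \<bullet> c i)) *\<^sub>R b j)" for i
  have \<beta>: "\<beta> i \<bullet> v = 2 * q (c i) v" for i v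
    by (simp add: \<beta>_def q_def inner_sum_left sum_distrib_left algebra_simps)
  define \<theta> where "\<theta> i = (\<alpha> i, \<beta> i)" for i
  have \<theta>: "\<theta> i \<bullet> (1, v) = \<alpha> i + \<beta> i \<bullet> v" for i v
    by (simp add: \<theta>_def)
  define T where "T = affine_label n \<theta>"
  have prob\<xi>: "prob_space \<xi>"
    using prob_space_distr[OF x\<xi>] marg by simp
  have sq\<xi>: "integrable \<xi> (\<lambda>x. (norm x)\<^sup>2)"
  proof -
    have "integrable (distr M \<xi> x) (\<lambda>x. (norm x)\<^sup>2)"
      using id_meas by (subst integrable_distr_eq[OF x\<xi>]) (auto simp: sq_int)
    then show ?thesis by (simp add: marg)
  qed
  interpret T: labelled_sample \<xi> "\<lambda>x. x" T n
    unfolding T_def by (intro labelled_sample_affine_label prob\<xi> id_meas sq\<xi> \<open>n \<ge> 1\<close>)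
  let ?A = "quantized_moment M x y n" and ?B = "quantized_moment \<xi> (\<lambda>x. x) T n"
  have A_outer: "?A \<bullet> outer u = q u u" for u
    by (simp add: quantized_moment_def q_def inner_sum_left inner_outer p_def b_def power2_eq_square)
  have "?A \<bullet> ?A = (\<Sum>i\<in>{1..n}. (1 / p i) * q (b i) (b i))"
    by (subst (2) quantized_moment_def) (simp add: inner_sum_right A_outer p_def b_def)
  also have "\<dots> = (\<Sum>i\<in>{1..n}. \<alpha> i * p i + \<beta> i \<bullet> b i)"
  proof (intro sum.cong refl)
    fix i
    show "(1 / p i) * q (b i) (b i) = \<alpha> i * p i + \<beta> i \<bullet> b i"
      by (cases "p i = 0") (auto simp: \<beta> \<alpha>_def c_def q_scale b0 q_zero field_simps)
  qed
  also have "\<dots> = (\<integral>w. \<alpha> (y w) + \<beta> (y w) \<bullet> x w \<partial>M)"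
    by (simp add: integral_affine_label p_def b_def)
  also have "\<dots> \<le> (\<integral>w. \<alpha> (T (x w)) + \<beta> (T (x w)) \<bullet> x w \<partial>M)"
  proof (intro integral_mono integral_affine_label(1))
    show "integrable M (\<lambda>w. \<alpha> (T (x w)) + \<beta> (T (x w)) \<bullet> x w)"
      using T.integral_affine_label(1)[of \<alpha> \<beta>]
      by (subst (asm) marg[symmetric], subst (asm) integrable_distr_eq[OF x\<xi>]) auto
    show "\<alpha> (y w) + \<beta> (y w) \<bullet> x w \<le> \<alpha> (T (x w)) + \<beta> (T (x w)) \<bullet> x w" if "w \<in> space M" for w
      using affine_label_maximal(2)[OF \<open>n \<ge> 1\<close> y_range[OF that], of \<theta> "x w"] by (simp add: \<theta> T_def)
  qed
  also have "\<dots> = (\<integral>v. \<alpha> (T v) + \<beta> (T v) \<bullet> v \<partial>\<xi>)"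
    using integral_distr[OF x\<xi>, of "\<lambda>v. \<alpha> (T v) + \<beta> (T v) \<bullet> v"]
      T.integral_affine_label(1)[of \<alpha> \<beta>] by (simp add: marg)
  also have "\<dots> = (\<Sum>i\<in>{1..n}. \<alpha> i * cell_mass \<xi> T i + \<beta> i \<bullet> cell_moment \<xi> (\<lambda>x. x) T i)"
    by (rule T.integral_affine_label(2))
  also have "\<dots> \<le> (\<Sum>i\<in>{1..n}. (1 / cell_mass \<xi> T i)
      * q (cell_moment \<xi> (\<lambda>x. x) T i) (cell_moment \<xi> (\<lambda>x. x) T i))"
  proof (intro sum_mono)
    fix i
    define s e where "s = cell_mass \<xi> T i" and "e = cell_moment \<xi> (\<lambda>x. x) T i"
    have "\<alpha> i * s + \<beta> i \<bullet> e \<le> (1 / s) * q e e"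
    proof (cases "s = 0")
      case True
      then show ?thesis using T.cell_null(1) by (simp add: s_def e_def)
    next
      case False
      then have s: "s > 0" using T.cell_mass_nonneg[of i] by (simp add: s_def)
      \<comment> \<open>Tangent inequality for the convex function \<open>q e e / s\<close> of \<open>(s, e)\<close>.\<close>
      have "0 \<le> s * q (e /\<^sub>R s - c i) (e /\<^sub>R s - c i)"
        using s q_nonneg by simp
      also have "\<dots> = (1 / s) * q e e - 2 * q (c i) e + s * q (c i) (c i)"
        using s by (simp add: q_diff q_scale field_simps)
      finally show ?thesis by (simp add: \<beta> \<alpha>_def algebra_simps)
    qed
    then show "\<alpha> i * cell_mass \<xi> T i + \<beta> i \<bullet> cell_moment \<xi> (\<lambda>x. x) T i
      \<le> (1 / cell_mass \<xi> T i) * q (cell_moment \<xi> (\<lambda>x. x) T i) (cell_moment \<xi> (\<lambda>x. x) T i)"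
      by (simp add: s_def e_def)
  qed
  also have "\<dots> = ?A \<bullet> ?B"
    by (subst (2) quantized_moment_def) (simp add: inner_sum_right A_outer)
  also have "\<dots> \<le> norm ?A * norm ?B"
    by (rule norm_cauchy_schwarz)
  finally have "norm ?A * norm ?A \<le> norm ?A * norm ?B"
    by (simp add: power2_norm_eq_inner[symmetric] power2_eq_square)
  then have "norm ?A \<le> norm ?B"
    by (cases "norm ?A = 0") (auto simp: mult_le_cancel_left)
  then show ?thesis using that unfolding T_def by blast
qed

section \<open>Gauged spaces with the Euclidean scalar product\<close>

text \<open>
  Square integrability of the gauge only controls \<open>x \<bullet> w\<close> for almost every \<open>w\<close>. The vectors \<open>w\<close> with
  square-integrable \<open>x \<bullet> w\<close> form a subspace \<open>W\<close>, so \<open>\<xi>\<close> is concentrated on \<open>W\<close>. Directions orthogonal to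
  \<open>W\<close> are therefore almost surely orthogonal to \<open>x\<close>, and every direction is square integrable.
\<close>

lemma integrable_norm_sq_if_inner_sq:
  fixes \<xi> :: "'a::euclidean_space measure"
  assumes "prob_space \<xi>" and [measurable]: "(\<lambda>x. x) \<in> borel_measurable \<xi>"
    and int: "integrable (\<xi> \<Otimes>\<^sub>M \<xi>) (\<lambda>(x, x'). (x \<bullet> x')\<^sup>2)"
  shows "integrable \<xi> (\<lambda>x. (norm x)\<^sup>2)"
proof -
  interpret prob_space \<xi> by fact
  interpret pair_sigma_finite \<xi> \<xi> ..
  define W where "W = {w. integrable \<xi> (\<lambda>x. (x \<bullet> w)\<^sup>2)}"
  have W: "subspace W"
    unfolding subspace_def
  proof (intro conjI ballI allI)
    show "0 \<in> W" by (simp add: W_def)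
    show "u + v \<in> W" if "u \<in> W" "v \<in> W" for u v
    proof -
      have "integrable \<xi> (\<lambda>x. 2 * (x \<bullet> u)\<^sup>2 + 2 * (x \<bullet> v)\<^sup>2)"
        using that by (simp add: W_def)
      moreover have "(x \<bullet> (u + v))\<^sup>2 \<le> 2 * (x \<bullet> u)\<^sup>2 + 2 * (x \<bullet> v)\<^sup>2" for x
        using zero_le_power2[of "x \<bullet> u - x \<bullet> v"]
        by (simp add: inner_add_right power2_sum power2_diff)
      ultimately have "integrable \<xi> (\<lambda>x. (x \<bullet> (u + v))\<^sup>2)"
        by (elim Bochner_Integration.integrable_bound) auto
      then show ?thesis by (simp add: W_def)
    qed
    show "s *\<^sub>R u \<in> W" if "u \<in> W" for s u
      using that by (simp add: W_def power_mult_distrib)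
  qed
  have ae: "AE x in \<xi>. x \<in> W"
    using AE_integrable_fst'[OF int] by (simp add: W_def inner_commute)
  have basis: "integrable \<xi> (\<lambda>x. (x \<bullet> e)\<^sup>2)" for e
  proof -
    obtain w v where w: "w \<in> span W" and v: "\<And>u. u \<in> span W \<Longrightarrow> orthogonal v u" and e: "e = w + v"
      using orthogonal_subspace_decomp_exists[of W e] by metis
    have "w \<in> W" using w W by (simp add: span_eq_iff[THEN iffD2])
    then have "integrable \<xi> (\<lambda>x. (x \<bullet> w)\<^sup>2)" by (simp add: W_def)
    moreover have "AE x in \<xi>. (x \<bullet> w)\<^sup>2 = (x \<bullet> e)\<^sup>2"
      using ae
    proof eventually_elim
      case (elim x)
      then have "x \<bullet> v = 0"
        using v[of x] by (simp add: span_base orthogonal_def inner_commute)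
      then show ?case by (simp add: e inner_add_right)
    qed
    ultimately show ?thesis
      by (subst (asm) integrable_cong_AE) auto
  qed
  have "integrable \<xi> (\<lambda>x. \<Sum>e\<in>Basis. (x \<bullet> e)\<^sup>2)"
    by (intro Bochner_Integration.integrable_sum basis)
  moreover have "(norm x)\<^sup>2 = (\<Sum>e\<in>Basis. (x \<bullet> e)\<^sup>2)" for x :: 'a
    unfolding power2_norm_eq_inner by (subst euclidean_inner) (simp add: power2_eq_square)
  ultimately show ?thesis by simp
qed

lemma id_borel_measurable_if_top_of_set:
  assumes "sets \<xi> = sets (borel_of (top_of_set X))"
  shows "space \<xi> = X" and "(\<lambda>x. x) \<in> borel_measurable \<xi>"
proof -
  have "{U. openin (top_of_set X) U} \<subseteq> Pow X"
    by (auto dest!: openin_imp_subset)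
  then have sets: "sets (borel_of (top_of_set X)) = sigma_sets X {U. openin (top_of_set X) U}"
    and space: "space (borel_of (top_of_set X)) = X"
    by (simp_all add: borel_of_def sets_measure_of space_measure_of)
  show X: "space \<xi> = X"
    using sets_eq_imp_space_eq[OF assms] space by simp
  show "(\<lambda>x. x) \<in> borel_measurable \<xi>"
  proof (rule borel_measurableI)
    fix S :: "'a set" assume "open S"
    then have "openin (top_of_set X) (S \<inter> X)"
      by (auto simp: openin_open)
    then show "(\<lambda>x. x) -` S \<inter> space \<xi> \<in> sets \<xi>"
      by (auto simp: X assms sets intro!: sigma_sets.Basic)
  qed
qed

section \<open>Couplings with a finite space\<close>

text \<open>
  Needed because the infimum of the empty set of reals carries no information.
\<close>

lemma coupling_nonempty:
  assumes "prob_space \<xi>" "prob_space \<upsilon>"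
  shows "couplings \<xi> \<upsilon> \<noteq> {}"
proof -
  interpret X: prob_space \<xi> by fact
  interpret Y: prob_space \<upsilon> by fact
  have "distr (\<xi> \<Otimes>\<^sub>M \<upsilon>) \<upsilon> snd = \<upsilon>"
  proof (rule measure_eqI)
    fix B assume "B \<in> sets (distr (\<xi> \<Otimes>\<^sub>M \<upsilon>) \<upsilon> snd)"
    then have B: "B \<in> sets \<upsilon>" by simp
    then have "snd -` B \<inter> space (\<xi> \<Otimes>\<^sub>M \<upsilon>) = space \<xi> \<times> B"
      using sets.sets_into_space by (fastforce simp: space_pair_measure)
    then show "emeasure (distr (\<xi> \<Otimes>\<^sub>M \<upsilon>) \<upsilon> snd) B = emeasure \<upsilon> B"
      using B by (simp add: emeasure_distr Y.emeasure_pair_measure_Times X.emeasure_space_1)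
  qed simp
  then have "\<xi> \<Otimes>\<^sub>M \<upsilon> \<in> couplings \<xi> \<upsilon>"
    by (simp add: couplings_def Y.distr_pair_fst)
  then show ?thesis by blast
qed

lemma graph_coupling:
  assumes [measurable]: "T \<in> \<xi> \<rightarrow>\<^sub>M \<upsilon>" and "distr \<xi> \<upsilon> T = \<upsilon>"
  shows "distr \<xi> (\<xi> \<Otimes>\<^sub>M \<upsilon>) (\<lambda>x. (x, T x)) \<in> couplings \<xi> \<upsilon>"
  using assms(2) by (simp add: couplings_def distr_distr o_def distr_id2)

lemma labelled_sample_coupling:
  fixes \<xi> :: "(real ^ 'd) measure"
  assumes "prob_space \<xi>" and [measurable]: "(\<lambda>x. x) \<in> borel_measurable \<xi>"
    and sq: "integrable \<xi> (\<lambda>x. (norm x)\<^sup>2)"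
    and \<upsilon>: "sets \<upsilon> = Pow {1..n}" and \<pi>: "\<pi> \<in> couplings \<xi> \<upsilon>"
  shows "fst \<in> \<pi> \<rightarrow>\<^sub>M \<xi>" "distr \<pi> \<xi> fst = \<xi>" "labelled_sample \<pi> fst snd n"
proof -
  have sets_\<pi>: "sets \<pi> = sets (\<xi> \<Otimes>\<^sub>M \<upsilon>)" and marg: "distr \<pi> \<xi> fst = \<xi>"
    using \<pi> by (auto simp: couplings_def)
  note [measurable_cong] = sets_\<pi>
  show fst_meas [measurable]: "fst \<in> \<pi> \<rightarrow>\<^sub>M \<xi>" by measurable
  show "distr \<pi> \<xi> fst = \<xi>" by fact
  have space_\<upsilon>: "space \<upsilon> = {1..n}"
    using \<upsilon> sets.top sets.sets_into_space by (metis Pow_iff Pow_top subset_antisym)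
  have "snd \<in> \<pi> \<rightarrow>\<^sub>M \<upsilon>" by measurable
  moreover have "(\<lambda>i. i) \<in> \<upsilon> \<rightarrow>\<^sub>M count_space UNIV"
    by (auto simp: measurable_def space_\<upsilon> \<upsilon>)
  ultimately have snd_meas: "snd \<in> \<pi> \<rightarrow>\<^sub>M count_space UNIV"
    by (rule measurable_compose)
  show "labelled_sample \<pi> fst snd n"
  proof (intro labelled_sample.intro labelled_sample_axioms.intro snd_meas)
    show "prob_space \<pi>"
      using prob_space_distrD[OF fst_meas] marg assms(1) by simp
    show "fst \<in> borel_measurable \<pi>"
      using measurable_compose[OF fst_meas assms(2)] by simp
    show "integrable \<pi> (\<lambda>z. (norm (fst z))\<^sup>2)"
      using sq by (subst (asm) marg[symmetric], subst (asm) integrable_distr_eq) auto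
    show "snd z \<in> {1..n}" if "z \<in> space \<pi>" for z
      using that sets_eq_imp_space_eq[OF sets_\<pi>] by (auto simp: space_pair_measure space_\<upsilon>)
  qed
qed

lemma distortion_coupling:
  fixes \<xi> :: "(real ^ 'd) measure"
  assumes "prob_space \<xi>" and id_meas: "(\<lambda>x. x) \<in> borel_measurable \<xi>"
    and sq: "integrable \<xi> (\<lambda>x. (norm x)\<^sup>2)"
    and \<upsilon>: "sets \<upsilon> = Pow {1..n}" and \<pi>: "\<pi> \<in> couplings \<xi> \<upsilon>"
  shows "distortion (\<bullet>) G \<pi> = sqrt (
     (norm (\<integral>x. outer x \<partial>\<xi>))\<^sup>2 - (norm (quantized_moment \<pi> fst snd n))\<^sup>2
     + (\<Sum>i\<in>{1..n}. \<Sum>j\<in>{1..n}. cell_mass \<pi> snd i * cell_mass \<pi> snd j *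
          (G i j - (cell_moment \<pi> fst snd i \<bullet> cell_moment \<pi> fst snd j)
             / (cell_mass \<pi> snd i * cell_mass \<pi> snd j))\<^sup>2))"
proof -
  note c = labelled_sample_coupling[OF assms]
  interpret labelled_sample \<pi> fst snd n by (rule c)
  have "(\<integral>x. outer x \<partial>\<xi>) = (\<integral>z. outer (fst z) \<partial>\<pi>)"
    by (subst c(2)[symmetric], subst integral_distr[OF c(1)])
       (auto intro: measurable_compose[OF id_meas])
  moreover have "distortion (\<bullet>) G \<pi> =
     sqrt (\<integral>(w, w'). \<bar>fst w \<bullet> fst w' - G (snd w) (snd w')\<bar>\<^sup>2 \<partial>(\<pi> \<Otimes>\<^sub>M \<pi>))"
    unfolding distortion_def
    by (intro arg_cong[where f = sqrt] Bochner_Integration.integral_cong) (auto split: prod.split)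
  ultimately show ?thesis
    unfolding integral_gauge_difference by simp
qed

lemma cell_statistics_graph:
  fixes \<xi> :: "(real ^ 'd) measure"
  assumes [measurable]: "(\<lambda>x. x) \<in> borel_measurable \<xi>" "T \<in> \<xi> \<rightarrow>\<^sub>M \<upsilon>"
    and \<upsilon>: "sets \<upsilon> = Pow {1..n}"
  defines "\<pi> \<equiv> distr \<xi> (\<xi> \<Otimes>\<^sub>M \<upsilon>) (\<lambda>x. (x, T x))"
  shows "cell_mass \<pi> snd i = cell_mass \<xi> T i"
    and "cell_moment \<pi> fst snd i = cell_moment \<xi> (\<lambda>x. x) T i"
    and "quantized_moment \<pi> fst snd n = quantized_moment \<xi> (\<lambda>x. x) T n"
proof -
  have space_\<upsilon>: "space \<upsilon> = {1..n}"
    using \<upsilon> sets.top sets.sets_into_space by (metis Pow_iff Pow_top subset_antisym)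
  have [measurable]: "(\<lambda>j. indicator {i} j :: real) \<in> borel_measurable \<upsilon>" for i
    using \<upsilon> by (auto simp: measurable_def space_\<upsilon>)
  have [measurable]: "(\<lambda>z. fst z) \<in> borel_measurable (\<xi> \<Otimes>\<^sub>M \<upsilon>)"
    using measurable_compose[OF measurable_fst assms(1)] by simp
  show mass: "cell_mass \<pi> snd i = cell_mass \<xi> T i" for i
    unfolding cell_mass_def \<pi>_def by (subst integral_distr) auto
  show moment: "cell_moment \<pi> fst snd i = cell_moment \<xi> (\<lambda>x. x) T i" for i
    unfolding cell_moment_def \<pi>_def by (subst integral_distr) auto
  show "quantized_moment \<pi> fst snd n = quantized_moment \<xi> (\<lambda>x. x) T n"
    by (simp add: quantized_moment_def mass moment)
qed

section \<open>Existence of an optimal quantization by a map\<close>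

theorem theorem4p7:
  fixes X :: "(real ^ 'd) set"
    and \<xi> :: "(real ^ 'd) measure"
    and m :: "(real ^ 'd) set \<Rightarrow> real ^ 'd"
    and n :: nat
  assumes "gm_space (top_of_set X, (\<bullet>), \<xi>)"
    and "n \<ge> 1"
    and "mean_map X \<xi> m"
  shows "\<exists>T \<in> \<xi> \<rightarrow>\<^sub>M count_space {1..n}.
    let V = (\<lambda>i. T -` {i} \<inter> X);
        G = (\<lambda>i i'. m (V i) \<bullet> m (V i'));
        \<upsilon> = point_measure {1..n} (\<lambda>i. emeasure \<xi> (V i));
        XX = (top_of_set X, (\<bullet>), \<xi>);
        YY = (discrete_topology {1..n}, G, \<upsilon>)
    in YY \<in> GM n \<and>
       GW2 XX YY = (INF Y\<in>GM n. GW2 XX Y) \<and>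
       distr \<xi> (\<xi> \<Otimes>\<^sub>M \<upsilon>) (\<lambda>x. (x, T x)) \<in> optimal_couplings XX YY"
proof -
  have prob: "prob_space \<xi>" and sets_\<xi>: "sets \<xi> = sets (borel_of (top_of_set X))"
    and "integrable (\<xi> \<Otimes>\<^sub>M \<xi>) (\<lambda>(x, x'). (x \<bullet> x')\<^sup>2)"
    using assms(1) by auto
  note X = id_borel_measurable_if_top_of_set[OF sets_\<xi>]
  have sq: "integrable \<xi> (\<lambda>x. (norm x)\<^sup>2)"
    by (rule integrable_norm_sq_if_inner_sq) fact+
  note basic = prob X(2) sq
  obtain T where "labelled_sample \<xi> (\<lambda>x. x) T n"
    and best: "\<And>\<theta>. norm (quantized_moment \<xi> (\<lambda>x. x) (affine_label n \<theta>) n)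
           \<le> norm (quantized_moment \<xi> (\<lambda>x. x) T n)"
    using exists_label_dominating_affine_labels[OF basic assms(2)] by blast
  then interpret T: labelled_sample \<xi> "\<lambda>x. x" T n by simp
  have T_meas: "T \<in> \<xi> \<rightarrow>\<^sub>M count_space {1..n}"
    using T.y_meas T.y_range by (auto simp: measurable_def)
  define V where "V = (\<lambda>i. T -` {i} \<inter> X)"
  define G where "G = (\<lambda>i i'. m (V i) \<bullet> m (V i'))"
  define \<upsilon> where "\<upsilon> = point_measure {1..n} (\<lambda>i. emeasure \<xi> (V i))"
  define \<pi> where "\<pi> = distr \<xi> (\<xi> \<Otimes>\<^sub>M \<upsilon>) (\<lambda>x. (x, T x))"
  define XX :: "(real ^ 'd) gm" where "XX = (top_of_set X, (\<bullet>), \<xi>)"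
  define YY where "YY = (discrete_topology {1..n}, G, \<upsilon>)"

  have V_sets: "V i \<in> sets \<xi>" for i
    using measurable_sets[OF T.y_meas, of "{i}"] by (simp add: V_def X)
  have sets_\<upsilon>: "sets \<upsilon> = Pow {1..n}" and space_\<upsilon>: "space \<upsilon> = {1..n}"
    by (simp_all add: \<upsilon>_def sets_point_measure space_point_measure)
  have T_\<upsilon>: "T \<in> \<xi> \<rightarrow>\<^sub>M \<upsilon>"
    using T_meas by (simp add: measurable_def sets_\<upsilon> space_\<upsilon>)
  have law: "distr \<xi> \<upsilon> T = \<upsilon>"
  proof (rule measure_eqI_finite[of _ "{1..n}"])
    fix i assume i: "i \<in> {1..n}"
    then have "emeasure (distr \<xi> \<upsilon> T) {i} = emeasure \<xi> (V i)"
      using T_\<upsilon> by (simp add: emeasure_distr sets_\<upsilon> V_def X)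
    also have "\<dots> = emeasure \<upsilon> {i}"
      using i by (simp add: \<upsilon>_def emeasure_point_measure_finite)
    finally show "emeasure (distr \<xi> \<upsilon> T) {i} = emeasure \<upsilon> {i}" .
  qed (simp_all add: sets_\<upsilon>)
  have "prob_space \<upsilon>"
    using T.prob_space_distr[OF T_\<upsilon>] law by simp
  then have YY: "YY \<in> GM n"
    by (auto simp: GM_def YY_def G_def sets_\<upsilon> inner_commute)
  have \<pi>: "\<pi> \<in> couplings \<xi> \<upsilon>"
    unfolding \<pi>_def by (rule graph_coupling[OF T_\<upsilon> law])

  \<comment> \<open>The common value of both sides of the equation between infima: attained by \<open>\<pi>\<close>, and a lower bound for the
      distortion of every coupling with every space in \<open>GM n\<close>.\<close>
  define R where "R = sqrt ((norm (\<integral>x. outer x \<partial>\<xi>))\<^sup>2 - (norm (quantized_moment \<xi> (\<lambda>x. x) T n))\<^sup>2)"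
  have mass_V: "cell_mass \<xi> T i = measure \<xi> (V i)" for i
  proof -
    have "cell_mass \<xi> T i = (\<integral>x. indicator (V i) x \<partial>\<xi>)"
      unfolding cell_mass_def
      by (intro Bochner_Integration.integral_cong) (auto simp: indicator_def V_def X)
    moreover have "V i \<inter> X = V i" by (auto simp: V_def)
    ultimately show ?thesis using V_sets by (simp add: X)
  qed
  have mean_V: "m (V i) = (1 / cell_mass \<xi> T i) *\<^sub>R cell_moment \<xi> (\<lambda>x. x) T i"
    if "cell_mass \<xi> T i \<noteq> 0" for i
  proof -
    have "cell_moment \<xi> (\<lambda>x. x) T i = (LINT x:V i|\<xi>. x)"
      unfolding cell_moment_def set_lebesgue_integral_def
      by (intro Bochner_Integration.integral_cong) (auto simp: indicator_def V_def X)
    moreover have "measure \<xi> (V i) > 0"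
      using that by (simp add: mass_V zero_less_measure_iff)
    ultimately show ?thesis
      using assms(3) V_sets by (simp add: mean_map_def mass_V)
  qed
  have R_eq: "distortion (\<bullet>) G \<pi> = R"
  proof -
    \<comment> \<open>On cells of positive mass \<open>m\<close> is the mean. The arbitrary values on null cells have weight zero.\<close>
    have zero: "cell_mass \<xi> T i * cell_mass \<xi> T j *
          (G i j - (cell_moment \<xi> (\<lambda>x. x) T i \<bullet> cell_moment \<xi> (\<lambda>x. x) T j)
             / (cell_mass \<xi> T i * cell_mass \<xi> T j))\<^sup>2 = 0" for i j
      by (cases "cell_mass \<xi> T i = 0 \<or> cell_mass \<xi> T j = 0") (auto simp: G_def mean_V)
    show ?thesis
      using distortion_coupling[OF basic sets_\<upsilon> \<pi>, of G]
      unfolding \<pi>_def cell_statistics_graph[OF X(2) T_\<upsilon> sets_\<upsilon>] zero R_def by simp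
  qed
  have R_le: "R \<le> distortion (\<bullet>) H \<rho>"
    if \<omega>: "sets \<omega> = Pow {1..n}" and \<rho>: "\<rho> \<in> couplings \<xi> \<omega>" for H \<omega> \<rho>
  proof -
    note c = labelled_sample_coupling[OF basic \<omega> \<rho>]
    interpret P: labelled_sample \<rho> fst snd n by (rule c)
    obtain \<theta> where "norm (quantized_moment \<rho> fst snd n)
        \<le> norm (quantized_moment \<xi> (\<lambda>x. x) (affine_label n \<theta>) n)"
      using P.exists_affine_label_improvement[OF c(1,2) X(2) assms(2)] by blast
    with best[of \<theta>] have "(norm (quantized_moment \<rho> fst snd n))\<^sup>2
        \<le> (norm (quantized_moment \<xi> (\<lambda>x. x) T n))\<^sup>2"
      by (intro power_mono) auto
    moreover have "0 \<le> (\<Sum>i\<in>{1..n}. \<Sum>j\<in>{1..n}. cell_mass \<rho> snd i * cell_mass \<rho> snd j *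
          (H i j - (cell_moment \<rho> fst snd i \<bullet> cell_moment \<rho> fst snd j)
             / (cell_mass \<rho> snd i * cell_mass \<rho> snd j))\<^sup>2)"
      by (intro sum_nonneg mult_nonneg_nonneg P.cell_mass_nonneg zero_le_power2)
    ultimately show ?thesis
      unfolding distortion_coupling[OF basic \<omega> \<rho>] R_def by (intro real_sqrt_le_mono) linarith
  qed

  have "GW2 XX YY = R"
    unfolding XX_def YY_def GW2.simps
  proof (rule antisym)
    show "(INF \<rho>\<in>couplings \<xi> \<upsilon>. distortion (\<bullet>) G \<rho>) \<le> R"
      unfolding R_eq[symmetric] using R_le[OF sets_\<upsilon>] \<pi> by (intro cINF_lower bdd_belowI2) auto
    show "R \<le> (INF \<rho>\<in>couplings \<xi> \<upsilon>. distortion (\<bullet>) G \<rho>)"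
      using \<pi> R_le[OF sets_\<upsilon>] by (intro cINF_greatest) auto
  qed
  moreover have R_le_GW2: "R \<le> GW2 XX Y" if "Y \<in> GM n" for Y
  proof -
    obtain H \<omega> where Y: "Y = (discrete_topology {1..n}, H, \<omega>)"
      and \<omega>: "prob_space \<omega>" "sets \<omega> = Pow {1..n}"
      using \<open>Y \<in> GM n\<close> by (auto simp: GM_def)
    show ?thesis
      unfolding XX_def Y GW2.simps
      by (intro cINF_greatest coupling_nonempty prob \<omega>(1) R_le[OF \<omega>(2)])
  qed
  ultimately have "GW2 XX YY = (INF Y\<in>GM n. GW2 XX Y)"
    using YY
    by (intro antisym cINF_greatest cINF_lower bdd_belowI2[of _ R]) auto
  moreover have "\<pi> \<in> optimal_couplings XX YY"
    using \<pi> R_le[OF sets_\<upsilon>] by (auto simp: XX_def YY_def R_eq)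
  ultimately show ?thesis
    using T_meas YY
    unfolding Let_def \<pi>_def XX_def YY_def \<upsilon>_def G_def V_def by blast
qed

end
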